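(* Let $X\sim E(\mu,K^{-1})$ be an elliptical random vector in $\mathbb{R}^d$, $d\ge 2$, and let $i\neq j$ in $V=\{1,\dots,d\}$. Then $K_{ij}=0$ if and only if $\operatorname{cov}(g(X_i),X_j\mid X_{(ij)})=0$ (almost surely) for any function $g$ for which this covariance exists.
   Context: A random vector $X=(X_1,\dots,X_d)$ has an elliptical distribution, written $X\sim E(\mu,\Sigma)$, if its characteristic function has the form $\boldsymbol t\mapsto \phi(\boldsymbol t^T\Sigma \boldsymbol t)\exp(i\mu^T \boldsymbol t)$ for some $\phi:[0,\infty)\to\mathbb{R}$, where $\mu\in\mathbb{R}^d$ and $\Sigma$ is a $d\times d$ symmetric matrix; $\phi$ is left implicit in the notation. Standing assumptions: $\Sigma$ is positive definite and, in the stochastic representation $X=\mu+\xi\,\Sigma^{1/2}U$ with $U$ uniform on the unit sphere of $\mathbb{R}^d$, $\xi\ge 0$ and $\xi$ independent of $U$, one has $0<\mathbb{E}\xi^2<\infty$. Put $K=\Sigma^{-1}$. $X_{(ij)}$ denotes the $(d-2)$-vector obtained from $X$ by removing $X_i$ and $X_j$ (if $d=2$, conditioning on $X_{(ij)}$ is no conditioning). Functions $g:\mathbb{R}\to\mathbb{R}$ are understood to be Borel measurable. *)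

theory Defs
  imports "HOL-Probability.Probability"
begin

definition pos_def_matrix :: "real^'n^'n \<Rightarrow> bool" where
  "pos_def_matrix A \<longleftrightarrow> transpose A = A \<and> (\<forall>x. x \<noteq> 0 \<longrightarrow> 0 < x \<bullet> (A *v x))"

(* The square root of a positive definite matrix, which is unique among positive definite matrices. *)
definition matrix_sqrt :: "real^'n^'n \<Rightarrow> real^'n^'n" where
  "matrix_sqrt A = (THE S. pos_def_matrix S \<and> S ** S = A)"

(* X ~ E(mu, Sigma).  The characteristic generator is a total function on the reals; only its
   values at points t^T Sigma t are constrained. *)
definition elliptical ::
    "'a measure \<Rightarrow> ('a \<Rightarrow> real^'n) \<Rightarrow> real^'n \<Rightarrow> real^'n^'n \<Rightarrow> bool" where
  "elliptical M X \<mu> \<Sigma> \<longleftrightarrow>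
     X \<in> borel_measurable M \<and> transpose \<Sigma> = \<Sigma> \<and>
     (\<exists>\<phi>::real \<Rightarrow> real. \<forall>t.
        (CLINT \<omega>|M. iexp (t \<bullet> X \<omega>)) = of_real (\<phi> (t \<bullet> (\<Sigma> *v t))) * iexp (\<mu> \<bullet> t))"

(* Normalised surface measure of the unit sphere, obtained by radially projecting the uniform
   distribution on the unit ball. *)
definition uniform_sphere :: "(real^'n) measure" where
  "uniform_sphere = distr (uniform_measure lborel (cball 0 1)) borel (\<lambda>x. x /\<^sub>R norm x)"

(* The representation X = mu + xi Sigma^(1/2) U is an equality in distribution, so xi and U may
   live on a probability space N different from that of X.  Independence is stated through the
   generated sigma-algebras, since indep_var wants both variables to have the same type. *)
definition stochastic_representation ::
    "'a measure \<Rightarrow> ('a \<Rightarrow> real^'n) \<Rightarrow> real^'n \<Rightarrow> real^'n^'n \<Rightarrow>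
     'b measure \<Rightarrow> ('b \<Rightarrow> real) \<Rightarrow> ('b \<Rightarrow> real^'n) \<Rightarrow> bool" where
  "stochastic_representation M X \<mu> \<Sigma> N \<xi> U \<longleftrightarrow>
     prob_space N \<and>
     \<xi> \<in> borel_measurable N \<and> U \<in> borel_measurable N \<and>
     prob_space.indep_set N
       {\<xi> -` A \<inter> space N | A. A \<in> sets borel} {U -` B \<inter> space N | B. B \<in> sets borel} \<and>
     (AE \<omega> in N. 0 \<le> \<xi> \<omega>) \<and>
     distr N borel U = uniform_sphere \<and>
     distr M borel X = distr N borel (\<lambda>\<omega>. \<mu> + \<xi> \<omega> *\<^sub>R (matrix_sqrt \<Sigma> *v U \<omega>))"

(* The sigma-algebra on the sample space generated by X with its i-th and j-th coordinates removed.
   If there are no other coordinates, this is the trivial sigma-algebra. *)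
definition sigma_remove2 ::
    "'a measure \<Rightarrow> ('a \<Rightarrow> real^'n) \<Rightarrow> 'n \<Rightarrow> 'n \<Rightarrow> 'a measure" where
  "sigma_remove2 M X i j =
     vimage_algebra (space M) (\<lambda>\<omega>. \<lambda>k\<in>UNIV - {i, j}. X \<omega> $ k) (PiM (UNIV - {i, j}) (\<lambda>_. borel))"

(* Existence of E[Y | F] as a real random variable, i.e. integrability with respect to almost every
   conditional law.  Y need not be integrable; real_cond_exp gives the right value here, being
   the difference of the conditional expectations of the positive and the negative part. *)
definition cond_exp_exists :: "'a measure \<Rightarrow> 'a measure \<Rightarrow> ('a \<Rightarrow> real) \<Rightarrow> bool" where
  "cond_exp_exists M F Y \<longleftrightarrow>
     Y \<in> borel_measurable M \<and> (AE \<omega> in M. nn_cond_exp M F (\<lambda>\<omega>. ennreal \<bar>Y \<omega>\<bar>) \<omega> < \<infinity>)"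

definition centred_product ::
    "'a measure \<Rightarrow> 'a measure \<Rightarrow> ('a \<Rightarrow> real) \<Rightarrow> ('a \<Rightarrow> real) \<Rightarrow> 'a \<Rightarrow> real" where
  "centred_product M F Y Z =
     (\<lambda>\<omega>. (Y \<omega> - real_cond_exp M F Y \<omega>) * (Z \<omega> - real_cond_exp M F Z \<omega>))"

definition cond_cov ::
    "'a measure \<Rightarrow> 'a measure \<Rightarrow> ('a \<Rightarrow> real) \<Rightarrow> ('a \<Rightarrow> real) \<Rightarrow> 'a \<Rightarrow> real" where
  "cond_cov M F Y Z = real_cond_exp M F (centred_product M F Y Z)"

definition cond_cov_exists ::
    "'a measure \<Rightarrow> 'a measure \<Rightarrow> ('a \<Rightarrow> real) \<Rightarrow> ('a \<Rightarrow> real) \<Rightarrow> bool" where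
  "cond_cov_exists M F Y Z \<longleftrightarrow>
     cond_exp_exists M F Y \<and> cond_exp_exists M F Z \<and>
     cond_exp_exists M F (centred_product M F Y Z)"

end

theory Submission
  imports Defs
begin

text \<open>
  The proof rests on one symmetry. Write \<open>S\<close> for the square root of \<open>\<Sigma>\<close> and
  \<open>score j = (K (X - \<mu>))\<^sub>j\<close>, which is the partial derivative in direction \<open>j\<close> of half the quadratic form
  \<open>(x - \<mu>)\<^sup>T K (x - \<mu>)\<close>. The affine map \<open>x \<mapsto> x - 2 (score j / K\<^sub>j\<^sub>j) e\<^sub>j\<close> fixes every coordinate except the
  \<open>j\<close>-th, preserves the quadratic form and changes the sign of \<open>score j\<close>. In the coordinates
  \<open>x = \<mu> + r S u\<close> it is the Householder reflection \<open>u \<mapsto> H u\<close> in the hyperplane orthogonal to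
  \<open>S K e\<^sub>j\<close>; since the uniform distribution on the sphere is invariant under \<open>H\<close> and the radius
  is independent of the direction, the law of \<open>X\<close> is invariant under the map
  (\<open>distr_radial_reflect\<close>). So, given all coordinates but the \<open>j\<close>-th, \<open>score j\<close> is distributed
  symmetrically about 0. Hence \<open>E(h \<cdot> score j | X\<^bsub>(ij)\<^esub>) = 0\<close> for every \<open>h\<close> that is a function of the
  coordinates other than \<open>j\<close>, whether or not the product is integrable
  (\<open>real_cond_exp_mult_antisymmetric\<close>).
  
  Let \<open>Y\<^sub>k = X\<^sub>k - E(X\<^sub>k | X\<^bsub>(ij)\<^esub>)\<close>. Since \<open>score j\<close> equals \<open>K\<^sub>j\<^sub>j X\<^sub>j + K\<^sub>i\<^sub>j X\<^sub>i\<close> plus a function of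
  \<open>X\<^bsub>(ij)\<^esub>\<close> and has conditional mean 0, it is almost surely \<open>K\<^sub>j\<^sub>j Y\<^sub>j + K\<^sub>i\<^sub>j Y\<^sub>i\<close>
  (\<open>score_eq_residuals\<close>). Both directions follow.
  
  If \<open>K\<^sub>i\<^sub>j = 0\<close>, then \<open>Y\<^sub>j = score j / K\<^sub>j\<^sub>j\<close>, so \<open>(g(X\<^sub>i) - E(g(X\<^sub>i) | X\<^bsub>(ij)\<^esub>)) Y\<^sub>j\<close> is of the form
  \<open>h \<cdot> score j\<close> and its conditional expectation vanishes (\<open>cond_cov_zero_if\<close>).
  
  Conversely, take \<open>g\<close> to be the identity, for which all moments needed are finite, and integrate:
  \<open>E(Y\<^sub>i Y\<^sub>j) = 0\<close>. Then \<open>0 = E(Y\<^sub>i \<cdot> score j) = K\<^sub>j\<^sub>j E(Y\<^sub>i Y\<^sub>j) + K\<^sub>i\<^sub>j E(Y\<^sub>i\<^sup>2) = K\<^sub>i\<^sub>j E(Y\<^sub>i\<^sup>2)\<close>, and likewise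
  \<open>K\<^sub>i\<^sub>j E(Y\<^sub>j\<^sup>2) = 0\<close>. If \<open>K\<^sub>i\<^sub>j \<noteq> 0\<close>, then \<open>Y\<^sub>i = Y\<^sub>j = 0\<close> and thus \<open>score j = 0\<close> almost surely. But
  \<open>score j\<close> is distributed as \<open>\<xi>\<close> times a nonzero linear functional of \<open>U\<close>, which almost surely does
  not vanish, so that \<open>\<xi>\<close> would be 0 (\<open>precision_zero_if_cond_cov_zero\<close>).
\<close>

section \<open>Square roots and inverses of positive definite matrices\<close>

lemma dot_symmetric_matrix:
  fixes A :: "real^'n^'n"
  assumes "transpose A = A"
  shows "x \<bullet> (A *v y) = (A *v x) \<bullet> y"
  by (metis assms dot_lmul_matrix transpose_matrix_vector)

text \<open>
  The constant is the minimum of the quadratic form on the compact unit sphere.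
\<close>

lemma pos_def_matrix_coercive:
  fixes A :: "real^'n^'n"
  assumes "pos_def_matrix A"
  obtains m where "m > 0" "\<And>x. m * (norm x)\<^sup>2 \<le> x \<bullet> (A *v x)"
proof -
  have "\<exists>x\<in>sphere (0::real^'n) 1. \<forall>y\<in>sphere 0 1. x \<bullet> (A *v x) \<le> y \<bullet> (A *v y)"
    by (intro continuous_attains_inf continuous_intros) auto
  then obtain z where z: "norm z = 1" "\<And>y. norm y = 1 \<Longrightarrow> z \<bullet> (A *v z) \<le> y \<bullet> (A *v y)"
    by (auto simp: dist_norm)
  show ?thesis
  proof
    show "z \<bullet> (A *v z) > 0"
      using assms z(1) unfolding pos_def_matrix_def by (metis norm_zero zero_neq_one)
    fix x
    show "z \<bullet> (A *v z) * (norm x)\<^sup>2 \<le> x \<bullet> (A *v x)"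
    proof (cases "x = 0")
      case False
      have "z \<bullet> (A *v z) \<le> (x /\<^sub>R norm x) \<bullet> (A *v (x /\<^sub>R norm x))"
        using z(2)[of "x /\<^sub>R norm x"] False by simp
      also have "\<dots> = (x \<bullet> (A *v x)) / (norm x)\<^sup>2"
        by (simp add: matrix_vector_mult_scaleR power2_eq_square field_simps)
      finally show ?thesis
        using False by (simp add: field_simps)
    qed auto
  qed
qed

text \<open>
  The difference \<open>D\<close> of two roots solves the Sylvester equation \<open>S D + D T = 0\<close>. Multiplying by \<open>D\<close> and
  taking traces gives \<open>tr (D S D) + tr (D T D) = 0\<close>, where both terms are nonnegative; the first is a
  sum of values of the form of \<open>S\<close> at the columns of \<open>D\<close>, so these columns are 0.
\<close>

lemma pos_def_sqrt_unique:
  fixes S T :: "real^'n^'n"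
  assumes S: "pos_def_matrix S" and T: "pos_def_matrix T" and eq: "S ** S = T ** T"
  shows "S = T"
proof -
  define D where "D = S - T"
  have sym: "transpose S = S" "transpose T = T"
    using S T by (auto simp: pos_def_matrix_def)
  have symD: "transpose D = D"
    unfolding D_def using sym by (simp add: transpose_def vec_eq_iff)
  have psd: "0 \<le> x \<bullet> (S *v x)" "0 \<le> x \<bullet> (T *v x)" for x
    using S T by (cases "x = 0"; force simp: pos_def_matrix_def)+
  have sylv: "S ** D + D ** T = 0"
    unfolding matrix_eq
  proof
    fix x
    have "S *v (S *v x) = T *v (T *v x)"
      using eq by (simp add: matrix_vector_mul_assoc)
    then show "(S ** D + D ** T) *v x = 0 *v x"
      by (simp add: D_def matrix_vector_mult_add_rdistrib matrix_vector_mult_diff_rdistrib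
          matrix_vector_mult_diff_distrib matrix_vector_mul_assoc[symmetric])
  qed
  have tr: "trace (D ** (P ** D)) = (\<Sum>k\<in>UNIV. (D *v axis k 1) \<bullet> (P *v (D *v axis k 1)))" for P :: "real^'n^'n"
  proof -
    have "(D ** (P ** D)) $ k $ k = (D *v axis k 1) \<bullet> (P *v (D *v axis k 1))" for k
    proof -
      have "(D ** (P ** D)) $ k $ k = axis k 1 \<bullet> ((D ** (P ** D)) *v axis k 1)"
        by (simp add: inner_axis' matrix_vector_mul_component column_def matrix_vector_mult_basis)
      then show ?thesis
        by (simp add: matrix_vector_mul_assoc[symmetric] dot_symmetric_matrix[OF symD])
    qed
    then show ?thesis by (simp add: trace_def)
  qed
  have "trace (D ** (S ** D)) + trace (D ** (T ** D)) = trace (D ** (S ** D)) + trace (D ** (D ** T))"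
    by (metis matrix_mul_assoc trace_mul_sym)
  also have "\<dots> = trace (D ** (S ** D + D ** T))"
    by (simp add: matrix_add_ldistrib trace_add)
  finally have "trace (D ** (S ** D)) + trace (D ** (T ** D)) = 0"
    by (simp add: sylv trace_def)
  moreover have "trace (D ** (T ** D)) \<ge> 0" "trace (D ** (S ** D)) \<ge> 0"
    unfolding tr by (intro sum_nonneg psd)+
  ultimately have "trace (D ** (S ** D)) = 0" by linarith
  then have "(D *v axis k 1) \<bullet> (S *v (D *v axis k 1)) = 0" for k
    unfolding tr by (subst (asm) sum_nonneg_eq_0_iff) (use psd in auto)
  then have "D *v axis k 1 = 0" for k
    using S unfolding pos_def_matrix_def by (metis less_irrefl)
  then have "D = 0"
    by (simp add: vec_eq_iff matrix_vector_mult_basis column_def)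
  then show ?thesis by (simp add: D_def)
qed

text \<open>
  After scaling by a small \<open>c > 0\<close>, the operator \<open>B = I - c A\<close> has norm \<open>q < 1\<close>. A root of \<open>c A\<close> of
  the form \<open>I - Y\<close> is a fixed point of \<open>Y \<mapsto> (B + Y\<^sup>2) / 2\<close>, because
  \<open>(I - Y)\<^sup>2 = I - 2 Y + Y\<^sup>2\<close>. This map is a contraction of the self-adjoint operators of norm at
  most \<open>r = (1 + q) / 2 < 1\<close>, and \<open>I - Y\<close> is positive definite since \<open>Y\<close> has norm less than 1.
\<close>

lemma pos_def_sqrt_exists:
  fixes A :: "real^'n^'n"
  assumes A: "pos_def_matrix A"
  shows "\<exists>S. pos_def_matrix S \<and> S ** S = A"
proof -
  have symA: "transpose A = A" using A by (simp add: pos_def_matrix_def)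
  obtain m where m: "m > 0" "\<And>x. m * (norm x)\<^sup>2 \<le> x \<bullet> (A *v x)"
    using pos_def_matrix_coercive[OF A] by metis
  obtain L where L: "L > 0" "\<And>x. norm (A *v x) \<le> norm x * L"
    using bounded_linear.pos_bounded[OF matrix_vector_mul_bounded_linear[of A]] by blast
  have "m \<le> L"
  proof -
    obtain e :: "real^'n" where e: "norm e = 1" using norm_axis_1 by blast
    have "m \<le> e \<bullet> (A *v e)" using m(2)[of e] e by simp
    also have "\<dots> \<le> norm e * norm (A *v e)" by (rule norm_cauchy_schwarz)
    also have "\<dots> \<le> L" using L(2)[of e] e by simp
    finally show ?thesis .
  qed
  \<comment> \<open>minimises the bound \<open>1 - 2 c m + c\<^sup>2 L\<^sup>2\<close> for the squared norm of \<open>I - c A\<close>\<close>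
  define c where "c = m / L\<^sup>2"
  define q where "q = sqrt (1 - (m / L)\<^sup>2)"
  have c: "c > 0" using m L by (simp add: c_def)
  have mL: "0 < m / L" "m / L \<le> 1" using m(1) L(1) \<open>m \<le> L\<close> by auto
  then have mL2: "(m / L)\<^sup>2 \<le> 1" "(m / L)\<^sup>2 > 0" by (auto simp: power_le_one_iff simp del: power_divide)
  have q: "0 \<le> q" "q < 1" "q\<^sup>2 = 1 - (m / L)\<^sup>2"
    unfolding q_def using mL2 by auto
  define B where "B = id_blinfun - c *\<^sub>R Blinfun ((*v) A)"
  have BA: "blinfun_apply (Blinfun ((*v) A)) x = A *v x" for x
    by (simp add: bounded_linear_Blinfun_apply)
  have B: "B x = x - c *\<^sub>R (A *v x)" for x
    by (simp add: B_def blinfun.diff_left blinfun.scaleR_left BA)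
  have normB: "norm B \<le> q"
  proof (rule norm_blinfun_bound[OF q(1)])
    fix x
    have "(norm (B x))\<^sup>2 = (norm x)\<^sup>2 - 2 * c * (x \<bullet> (A *v x)) + c\<^sup>2 * (norm (A *v x))\<^sup>2"
      unfolding B power2_norm_eq_inner
      by (simp add: inner_diff inner_commute algebra_simps power2_eq_square del: inner_same_Basis)
    also have "\<dots> \<le> (norm x)\<^sup>2 - 2 * c * (m * (norm x)\<^sup>2) + c\<^sup>2 * (norm x * L)\<^sup>2"
      using m(2)[of x] L(2)[of x] c by (intro add_mono diff_mono mult_left_mono power_mono) auto
    also have "\<dots> = (1 - (m / L)\<^sup>2) * (norm x)\<^sup>2"
      using L(1) by (simp add: c_def field_simps power2_eq_square)
    also have "\<dots> = (q * norm x)\<^sup>2"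
      by (simp add: power_mult_distrib q(3))
    finally show "norm (B x) \<le> q * norm x"
      using q(1) by (simp add: power2_le_iff_abs_le)
  qed
  have symB: "x \<bullet> B y = B x \<bullet> y" for x y
    unfolding B by (simp add: inner_diff dot_symmetric_matrix[OF symA])
  define r where "r = (1 + q) / 2"
  have r: "0 < r" "r < 1" "q + r * r \<le> 2 * r"
  proof -
    show "0 < r" "r < 1" using q by (auto simp: r_def)
    have "r * r \<le> 1" using q by (intro mult_le_one) (auto simp: r_def)
    then show "q + r * r \<le> 2 * r" by (simp add: r_def)
  qed
  define V where "V = {Y :: (real^'n) \<Rightarrow>\<^sub>L (real^'n). norm Y \<le> r \<and> (\<forall>x y. x \<bullet> blinfun_apply Y y = blinfun_apply Y x \<bullet> y)}"
  define f where "f Y = (1/2) *\<^sub>R (B + (Y o\<^sub>L Y))" for Y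
  have "\<exists>!Y\<in>V. f Y = Y"
  proof (rule Banach_fix)
    have "closed V"
      unfolding V_def by (intro closed_Collect_conj closed_Collect_all closed_Collect_le closed_Collect_eq continuous_intros)
    then show "Topological_Spaces.complete V" by (simp add: complete_eq_closed)
    have "0 \<in> V" using r by (simp add: V_def)
    then show "V \<noteq> {}" by blast
    show "f ` V \<subseteq> V"
    proof
      fix Z assume "Z \<in> f ` V"
      then obtain Y where Y: "Y \<in> V" "Z = f Y" by blast
      have "norm Z = norm (B + (Y o\<^sub>L Y)) / 2" by (simp add: Y f_def)
      also have "\<dots> \<le> (q + r * r) / 2"
      proof -
        have "norm (Y o\<^sub>L Y) \<le> r * r"
          using norm_blinfun_compose[of Y Y] Y(1) r(1) mult_mono[of "norm Y" r "norm Y" r]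
          by (auto simp: V_def)
        then show ?thesis using normB norm_triangle_ineq[of B "Y o\<^sub>L Y"] by simp
      qed
      also have "\<dots> \<le> r" using r by simp
      finally have 1: "norm Z \<le> r" .
      have "x \<bullet> Z y = Z x \<bullet> y" for x y
      proof -
        have s: "x \<bullet> blinfun_apply Y y = blinfun_apply Y x \<bullet> y" for x y using Y(1) by (auto simp: V_def)
        show ?thesis
          by (simp add: Y(2) f_def blinfun.scaleR_left blinfun.add_left inner_add symB s)
      qed
      with 1 show "Z \<in> V" by (simp add: V_def)
    qed
    show "dist (f Y) (f Z) \<le> r * dist Y Z" if "Y \<in> V" "Z \<in> V" for Y Z
    proof -
      have "f Y - f Z = (1/2) *\<^sub>R ((Y o\<^sub>L (Y - Z)) + ((Y - Z) o\<^sub>L Z))"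
        by (rule blinfun_eqI) (simp add: f_def blinfun.bilinear_simps scaleR_right_distrib scaleR_right_diff_distrib)
      then have "dist (f Y) (f Z) = norm ((Y o\<^sub>L (Y - Z)) + ((Y - Z) o\<^sub>L Z)) / 2"
        by (simp add: dist_norm)
      also have "\<dots> \<le> (norm Y * norm (Y - Z) + norm (Y - Z) * norm Z) / 2"
        by (intro divide_right_mono norm_triangle_mono norm_blinfun_compose) auto
      also have "\<dots> \<le> (r * norm (Y - Z) + norm (Y - Z) * r) / 2"
        using that r(1) by (intro divide_right_mono add_mono mult_mono) (auto simp: V_def)
      finally show ?thesis by (simp add: dist_norm)
    qed
  qed (use r in auto)
  then obtain Y where Y: "Y \<in> V" "f Y = Y" by blast
  define R where "R = id_blinfun - Y"
  define S where "S = (1 / sqrt c) *\<^sub>R matrix (blinfun_apply R)"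
  have Sv: "S *v x = (1 / sqrt c) *\<^sub>R R x" for x
    by (simp add: S_def scaleR_matrix_vector_assoc[symmetric] matrix_works blinfun.bounded_linear_right bounded_linear.linear)
  have RR: "R (R x) = c *\<^sub>R (A *v x)" for x
  proof -
    have "2 *\<^sub>R Y x = 2 *\<^sub>R f Y x"
      by (simp add: Y(2))
    also have "\<dots> = B x + Y (Y x)"
      by (simp add: f_def blinfun.scaleR_left blinfun.add_left)
    finally have "2 *\<^sub>R Y x = B x + Y (Y x)" .
    then show ?thesis
      by (simp add: R_def blinfun.bilinear_simps B scaleR_2 algebra_simps)
  qed
  have "S ** S = A"
    unfolding matrix_eq using c by (simp add: matrix_vector_mul_assoc[symmetric] Sv blinfun.scaleR_right RR)
  moreover have "pos_def_matrix S"
    unfolding pos_def_matrix_def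
  proof safe
    have "x \<bullet> (S *v y) = (S *v x) \<bullet> y" for x y
      using Y(1) by (simp add: Sv R_def blinfun.bilinear_simps inner_diff V_def)
    then have "axis i 1 \<bullet> (S *v axis k 1) = (S *v axis i 1) \<bullet> axis k 1" for i k .
    then show "transpose S = S"
      by (simp add: vec_eq_iff transpose_def inner_axis inner_axis' matrix_vector_mult_basis column_def)
    fix x :: "real^'n" assume x: "x \<noteq> 0"
    have "x \<bullet> Y x \<le> norm x * norm (Y x)" by (rule norm_cauchy_schwarz)
    also have "\<dots> \<le> norm x * (r * norm x)"
      using Y(1) norm_blinfun[of Y x]
      by (intro mult_left_mono order.trans[OF norm_blinfun] mult_right_mono) (auto simp: V_def)
    also have "\<dots> < norm x * norm x" using r x by simp
    finally have "x \<bullet> Y x < x \<bullet> x" by (simp add: power2_norm_eq_inner flip: power2_eq_square)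
    then show "0 < x \<bullet> (S *v x)"
      using c by (simp add: Sv R_def blinfun.bilinear_simps inner_diff)
  qed
  ultimately show ?thesis by blast
qed

lemma matrix_sqrt:
  assumes "pos_def_matrix A"
  shows "pos_def_matrix (matrix_sqrt A)" "matrix_sqrt A ** matrix_sqrt A = A"
proof -
  have "\<exists>!S. pos_def_matrix S \<and> S ** S = A"
    using pos_def_sqrt_exists[OF assms] pos_def_sqrt_unique by metis
  from theI'[OF this] show "pos_def_matrix (matrix_sqrt A)" "matrix_sqrt A ** matrix_sqrt A = A"
    by (simp_all add: matrix_sqrt_def)
qed

lemma matrix_inv_mult:
  assumes "pos_def_matrix A"
  shows "A ** matrix_inv A = mat 1" "matrix_inv A ** A = mat 1"
proof -
  have "A *v x = 0 \<Longrightarrow> x = 0" for x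
    using assms unfolding pos_def_matrix_def by (metis inner_zero_right less_irrefl)
  then have "invertible A"
    unfolding invertible_left_inverse matrix_left_invertible_ker by blast
  then have "A ** matrix_inv A = mat 1 \<and> matrix_inv A ** A = mat 1"
    unfolding invertible_def matrix_inv_def by (rule someI_ex)
  then show "A ** matrix_inv A = mat 1" "matrix_inv A ** A = mat 1"
    by simp_all
qed

lemma pos_def_matrix_inv:
  assumes A: "pos_def_matrix A"
  shows "pos_def_matrix (matrix_inv A)"
  unfolding pos_def_matrix_def
proof safe
  have sym: "transpose A = A" using A by (simp add: pos_def_matrix_def)
  have "transpose (matrix_inv A) ** A = mat 1"
    by (metis matrix_inv_mult(1)[OF A] matrix_transpose_mul sym transpose_mat)
  then show "transpose (matrix_inv A) = matrix_inv A"
    by (metis matrix_inv_mult(1)[OF A] matrix_mul_assoc matrix_mul_lid matrix_mul_rid)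
  fix x :: "real^'a" assume "x \<noteq> 0"
  define w where "w = matrix_inv A *v x"
  have x: "x = A *v w"
    by (simp add: w_def matrix_vector_mul_assoc matrix_inv_mult[OF A])
  with \<open>x \<noteq> 0\<close> have "w \<noteq> 0" by auto
  then have "0 < w \<bullet> (A *v w)" using A by (simp add: pos_def_matrix_def)
  then show "0 < x \<bullet> (matrix_inv A *v x)"
    by (simp add: x[symmetric] inner_commute flip: w_def)
qed

lemma matrix_sqrt_inv:
  assumes "pos_def_matrix \<Sigma>"
  shows "matrix_sqrt \<Sigma> *v (matrix_sqrt \<Sigma> *v (matrix_inv \<Sigma> *v x)) = x"
  by (simp add: matrix_vector_mul_assoc matrix_sqrt[OF assms] matrix_inv_mult[OF assms] matrix_mul_assoc)

text \<open>
  In the coordinates \<open>x = S u\<close> the linear functional \<open>x \<mapsto> (matrix_inv \<Sigma> x)\<^sub>j\<close> is the inner product with a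
  vector whose image under \<open>S\<close> is \<open>e\<^sub>j\<close>, by \<open>matrix_sqrt_inv\<close>.
\<close>

lemma matrix_inv_sqrt_nth:
  fixes \<Sigma> :: "real^'n^'n"
  assumes \<Sigma>: "pos_def_matrix \<Sigma>"
  shows "(matrix_inv \<Sigma> *v (matrix_sqrt \<Sigma> *v u)) $ j = (matrix_sqrt \<Sigma> *v (matrix_inv \<Sigma> *v axis j 1)) \<bullet> u"
proof -
  have sym: "transpose (matrix_inv \<Sigma>) = matrix_inv \<Sigma>" "transpose (matrix_sqrt \<Sigma>) = matrix_sqrt \<Sigma>"
    using pos_def_matrix_inv[OF \<Sigma>] matrix_sqrt(1)[OF \<Sigma>] by (auto simp: pos_def_matrix_def)
  have "(matrix_inv \<Sigma> *v (matrix_sqrt \<Sigma> *v u)) $ j = axis j 1 \<bullet> (matrix_inv \<Sigma> *v (matrix_sqrt \<Sigma> *v u))"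
    by (simp add: inner_axis')
  also have "\<dots> = (matrix_sqrt \<Sigma> *v (matrix_inv \<Sigma> *v axis j 1)) \<bullet> u"
    by (simp only: dot_symmetric_matrix[OF sym(1)] dot_symmetric_matrix[OF sym(2)])
  finally show ?thesis .
qed

section \<open>Isometries and the uniform distribution on the sphere\<close>

lemma lborel_translation_invariant:
  fixes a :: "'a::euclidean_space"
  shows "distr lborel borel (\<lambda>x. x + a) = lborel"
  using lborel_distr_plus[of a] by (simp add: add.commute[of _ a])

text \<open>
  The image measure \<open>\<nu>\<close> is again translation invariant, and a translation invariant measure is a
  multiple of Lebesgue measure \<open>\<lambda>\<close>: for a unit ball \<open>B\<close> centred at 0, Fubini and translation of either
  variable turn \<open>\<nu>(A) \<lambda>(B)\<close> into \<open>\<lambda>(A) \<nu>(B)\<close>, using that \<open>B = -B\<close>. The isometry maps \<open>B\<close> onto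
  itself, so \<open>\<nu>(B) = \<lambda>(B)\<close> and the factor is 1.
\<close>

lemma lborel_linear_isometry:
  fixes H :: "'a::euclidean_space \<Rightarrow> 'a"
  assumes lin: "linear H" and iso: "\<And>x. norm (H x) = norm x"
  shows "distr lborel borel H = lborel"
proof (rule measure_eqI)
  have cont: "continuous_on UNIV H" using lin by (simp add: linear_continuous_on linear_conv_bounded_linear)
  then have Hm [measurable]: "H \<in> borel_measurable borel"
    by (rule borel_measurable_continuous_onI)
  obtain G where G: "linear G" "\<And>x. H (G x) = x" "\<And>x. G (H x) = x"
  proof -
    have "inj H" using lin iso by (metis linear_injective_0 norm_eq_zero)
    then obtain G where "linear G" "(\<forall>x. G (H x) = x) \<and> (\<forall>x. H (G x) = x)"
      using linear_injective_isomorphism[OF lin] by blast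
    then show ?thesis using that by blast
  qed
  define \<nu> where "\<nu> = distr lborel borel H"
  have sets\<nu> [measurable_cong]: "sets \<nu> = sets borel" by (simp add: \<nu>_def)
  have em: "emeasure \<nu> A = emeasure lborel (H -` A)" if "A \<in> sets borel" for A
    using that by (simp add: \<nu>_def emeasure_distr)
  have trans: "(\<integral>\<^sup>+x. f (x + y) \<partial>\<nu>) = (\<integral>\<^sup>+x. f x \<partial>\<nu>)"
    if [measurable]: "f \<in> borel_measurable borel" for f :: "'a \<Rightarrow> ennreal" and y
  proof -
    have "(\<integral>\<^sup>+x. f (x + y) \<partial>\<nu>) = (\<integral>\<^sup>+x. f (H (x + G y)) \<partial>lborel)"
      unfolding \<nu>_def by (subst nn_integral_distr) (auto simp: linear_add[OF lin] G)
    also have "\<dots> = (\<integral>\<^sup>+x. f (H x) \<partial>distr lborel borel (\<lambda>x. x + G y))"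
      by (subst nn_integral_distr) auto
    also have "\<dots> = (\<integral>\<^sup>+x. f x \<partial>\<nu>)"
      unfolding lborel_translation_invariant \<nu>_def by (subst nn_integral_distr) auto
    finally show ?thesis .
  qed
  have ball: "H -` ball 0 R = ball 0 R" for R by (auto simp: iso)
  have "sigma_finite_measure \<nu>"
  proof
    show "\<exists>A. countable A \<and> A \<subseteq> sets \<nu> \<and> \<Union> A = space \<nu> \<and> (\<forall>a\<in>A. emeasure \<nu> a \<noteq> \<infinity>)"
    proof (intro exI conjI ballI)
      show "countable (range (\<lambda>n. ball (0::'a) (real n)))" by auto
      show "\<Union> (range (\<lambda>n. ball (0::'a) (real n))) = space \<nu>"
        by (auto simp: \<nu>_def reals_Archimedean2)
      show "emeasure \<nu> a \<noteq> \<infinity>" if "a \<in> range (\<lambda>n. ball (0::'a) (real n))" for a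
        using that emeasure_lborel_ball_finite[of "0::'a"] by (auto simp: em ball less_top)
    qed (auto simp: sets\<nu>)
  qed
  then interpret \<nu>: sigma_finite_measure \<nu> .
  interpret pair_sigma_finite \<nu> "lborel :: 'a measure" ..
  fix A assume "A \<in> sets (distr lborel borel H)"
  then have A [measurable]: "A \<in> sets borel" by simp
  let ?B = "ball (0::'a) 1"
  have [measurable]: "?B \<in> sets borel" by simp
  have "emeasure \<nu> A * emeasure lborel ?B = (\<integral>\<^sup>+y. (\<integral>\<^sup>+x. indicator A x \<partial>\<nu>) * indicator ?B y \<partial>lborel)"
    by (subst nn_integral_cmult) (auto simp: sets\<nu> intro!: borel_measurable_indicator)
  also have "\<dots> = (\<integral>\<^sup>+y. (\<integral>\<^sup>+x. indicator A (x + y) * indicator ?B y \<partial>\<nu>) \<partial>lborel)"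
    by (subst nn_integral_multc) (auto simp: trans[of "indicator A"])
  also have "\<dots> = (\<integral>\<^sup>+x. (\<integral>\<^sup>+y. indicator A (x + y) * indicator ?B y \<partial>lborel) \<partial>\<nu>)"
    by (rule Fubini') measurable
  also have "\<dots> = (\<integral>\<^sup>+x. (\<integral>\<^sup>+y. indicator A y * indicator ?B (y - x) \<partial>lborel) \<partial>\<nu>)"
  proof (rule nn_integral_cong)
    fix x
    have "(\<integral>\<^sup>+y. indicator A y * indicator ?B (y - x) \<partial>lborel)
        = (\<integral>\<^sup>+y. indicator A y * indicator ?B (y - x) \<partial>distr lborel borel (\<lambda>y. y + x))"
      by (simp only: lborel_translation_invariant)
    also have "\<dots> = (\<integral>\<^sup>+y. indicator A (x + y) * indicator ?B y \<partial>lborel)"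
      by (subst nn_integral_distr) (auto simp: add.commute)
    finally show "(\<integral>\<^sup>+y. indicator A (x + y) * indicator ?B y \<partial>lborel)
        = (\<integral>\<^sup>+y. indicator A y * indicator ?B (y - x) \<partial>lborel)" by simp
  qed
  also have "\<dots> = (\<integral>\<^sup>+y. (\<integral>\<^sup>+x. indicator A y * indicator ?B (y - x) \<partial>\<nu>) \<partial>lborel)"
    by (rule Fubini'[symmetric]) measurable
  also have "\<dots> = (\<integral>\<^sup>+y. indicator A y * emeasure \<nu> ?B \<partial>lborel)"
  proof (rule nn_integral_cong)
    fix y
    have "(\<integral>\<^sup>+x. indicator ?B (y - x) \<partial>\<nu>) = (\<integral>\<^sup>+x. indicator ?B (y - (x + y)) \<partial>\<nu>)"
      by (rule trans[symmetric]) measurable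
    also have "\<dots> = (\<integral>\<^sup>+x. indicator ?B x \<partial>\<nu>)"
      by (intro nn_integral_cong) (simp add: indicator_def)
    finally show "(\<integral>\<^sup>+x. indicator A y * indicator ?B (y - x) \<partial>\<nu>) = indicator A y * emeasure \<nu> ?B"
      by (subst nn_integral_cmult) (auto simp: sets\<nu>)
  qed
  also have "\<dots> = emeasure lborel A * emeasure lborel ?B"
    by (subst nn_integral_multc) (auto simp: em ball)
  finally have "emeasure \<nu> A * emeasure lborel ?B = emeasure lborel A * emeasure lborel ?B" .
  moreover have "emeasure lborel ?B \<noteq> 0" "emeasure lborel ?B \<noteq> \<infinity>"
    using emeasure_lborel_ball_finite[of "0::'a" 1] open_not_negligible[of ?B]
    by (auto simp: negligible_iff_emeasure0)
  ultimately have "emeasure \<nu> A = emeasure lborel A"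
    by (metis ennreal_mult_divide_eq infinity_ennreal_def)
  then show "emeasure (distr lborel borel H) A = emeasure lborel A" by (simp add: \<nu>_def)
qed auto

lemma uniform_sphere_linear_isometry:
  fixes H :: "real^'n \<Rightarrow> real^'n"
  assumes lin: "linear H" and iso: "\<And>x. norm (H x) = norm x"
  shows "distr uniform_sphere borel H = uniform_sphere"
proof -
  let ?C = "cball (0::real^'n) 1"
  have cont: "continuous_on UNIV H" using lin by (simp add: linear_continuous_on linear_conv_bounded_linear)
  then have Hm [measurable]: "H \<in> borel_measurable borel"
    by (rule borel_measurable_continuous_onI)
  have U: "distr (uniform_measure lborel ?C) borel H = uniform_measure lborel ?C"
  proof (rule measure_eqI)
    fix A assume "A \<in> sets (distr (uniform_measure lborel ?C) borel H)"
    then have A [measurable]: "A \<in> sets borel" by simp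
    have "emeasure (distr (uniform_measure lborel ?C) borel H) A = emeasure lborel (?C \<inter> H -` A) / emeasure lborel ?C"
      using measurable_sets_borel[OF Hm A] by (subst emeasure_distr) (auto simp: emeasure_uniform_measure)
    also have "?C \<inter> H -` A = H -` (?C \<inter> A)" by (auto simp: iso)
    also have "emeasure lborel \<dots> = emeasure (distr lborel borel H) (?C \<inter> A)"
      by (subst emeasure_distr) auto
    finally show "emeasure (distr (uniform_measure lborel ?C) borel H) A = emeasure (uniform_measure lborel ?C) A"
      by (simp add: lborel_linear_isometry[OF assms] emeasure_uniform_measure)
  qed auto
  have "distr uniform_sphere borel H = distr (uniform_measure lborel ?C) borel (\<lambda>x. H (x /\<^sub>R norm x))"
    unfolding uniform_sphere_def by (subst distr_distr) (auto simp: comp_def)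
  also have "\<dots> = distr (uniform_measure lborel ?C) borel (\<lambda>x. H x /\<^sub>R norm (H x))"
    by (simp add: iso linear_scale[OF lin])
  also have "\<dots> = distr (distr (uniform_measure lborel ?C) borel H) borel (\<lambda>x. x /\<^sub>R norm x)"
    by (subst distr_distr) (auto simp: comp_def)
  finally show ?thesis by (simp add: U uniform_sphere_def)
qed

lemma uniform_sphere_norm_le: "AE u in uniform_sphere. norm u \<le> 1"
  unfolding uniform_sphere_def by (subst AE_distr_iff) (auto simp: divide_simps)

lemma uniform_sphere_hyperplane:
  fixes a :: "real^'n"
  assumes "a \<noteq> 0"
  shows "AE u in uniform_sphere. a \<bullet> u \<noteq> 0"
proof -
  have "AE x in lebesgue. x \<notin> {x. a \<bullet> x = 0}"
    using negligible_hyperplane[of a 0] assms by (intro AE_not_in) (auto simp: negligible_iff_null_sets)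
  then have "AE x in lborel. a \<bullet> x \<noteq> 0" by (simp add: AE_completion_iff)
  then have *: "AE x in lborel. a \<bullet> (x /\<^sub>R norm x) \<noteq> 0" by eventually_elim auto
  have "AE x in uniform_measure lborel (cball (0::real^'n) 1). a \<bullet> (x /\<^sub>R norm x) \<noteq> 0"
    using * by (intro AE_uniform_measureI) auto
  then show ?thesis
    unfolding uniform_sphere_def by (subst AE_distr_iff) auto
qed

section \<open>Invariance under coordinate reflections\<close>

text \<open>
  The reflection in direction \<open>e\<^sub>j\<close> that is orthogonal for the bilinear form of a symmetric \<open>K\<close> and centred
  at \<open>\<mu>\<close>.
\<close>

definition reflect :: "real^'n^'n \<Rightarrow> real^'n \<Rightarrow> 'n \<Rightarrow> real^'n \<Rightarrow> real^'n" where
  "reflect K \<mu> j x = x - (2 * (K *v (x - \<mu>)) $ j / K $ j $ j) *\<^sub>R axis j 1"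

lemma reflect_nth: "k \<noteq> j \<Longrightarrow> reflect K \<mu> j x $ k = x $ k"
  by (simp add: reflect_def axis_def)

lemma reflect_score:
  assumes "K $ j $ j \<noteq> 0"
  shows "(K *v (reflect K \<mu> j x - \<mu>)) $ j = - (K *v (x - \<mu>)) $ j"
proof -
  have "reflect K \<mu> j x - \<mu> = (x - \<mu>) - (2 * (K *v (x - \<mu>)) $ j / K $ j $ j) *\<^sub>R axis j 1"
    by (simp add: reflect_def)
  then show ?thesis
    using assms by (simp add: matrix_vector_mult_diff_distrib matrix_vector_mult_scaleR
        matrix_vector_mult_basis column_def)
qed

lemma measurable_matrix_vector_mult [measurable]:
  fixes A :: "real^'n^'m"
  assumes [measurable]: "f \<in> borel_measurable M"
  shows "(\<lambda>x. A *v f x) \<in> borel_measurable M"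
proof (rule measurable_compose[OF assms])
  show "(\<lambda>x. A *v x) \<in> borel_measurable borel"
    by (intro borel_measurable_continuous_onI continuous_intros)
qed

lemma measurable_vec_nth [measurable]:
  fixes f :: "'a \<Rightarrow> real^'n"
  assumes "f \<in> borel_measurable M"
  shows "(\<lambda>x. f x $ k) \<in> borel_measurable M"
proof (rule measurable_compose[OF assms])
  show "(\<lambda>x::real^'n. x $ k) \<in> borel_measurable borel"
    by (intro borel_measurable_continuous_onI continuous_intros)
qed

lemma measurable_reflect [measurable]: "reflect K \<mu> j \<in> borel_measurable borel"
  unfolding reflect_def[abs_def] by measurable

text \<open>
  A version of the product formula for independent random variables whose values may lie in different
  types.
\<close>

lemma distr_pair_indep:
  assumes "prob_space N" and [measurable]: "f \<in> measurable N S" "g \<in> measurable N T"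
    and ind: "prob_space.indep_set N {f -` A \<inter> space N | A. A \<in> sets S} {g -` B \<inter> space N | B. B \<in> sets T}"
  shows "distr N (S \<Otimes>\<^sub>M T) (\<lambda>\<omega>. (f \<omega>, g \<omega>)) = distr N S f \<Otimes>\<^sub>M distr N T g"
proof (rule sym, rule pair_measure_eqI)
  interpret N: prob_space N by fact
  show "sigma_finite_measure (distr N S f)" "sigma_finite_measure (distr N T g)"
    by (auto intro!: prob_space_imp_sigma_finite N.prob_space_distr)
  show "sets (distr N S f \<Otimes>\<^sub>M distr N T g) = sets (distr N (S \<Otimes>\<^sub>M T) (\<lambda>\<omega>. (f \<omega>, g \<omega>)))"
    by (simp cong: sets_pair_measure_cong)
  fix A B assume "A \<in> sets (distr N S f)" "B \<in> sets (distr N T g)"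
  then have [measurable]: "A \<in> sets S" "B \<in> sets T" by auto
  have "N.prob ((f -` A \<inter> space N) \<inter> (g -` B \<inter> space N)) = N.prob (f -` A \<inter> space N) * N.prob (g -` B \<inter> space N)"
    by (rule N.indep_setD[OF ind]) auto
  moreover have "(\<lambda>\<omega>. (f \<omega>, g \<omega>)) -` (A \<times> B) \<inter> space N = (f -` A \<inter> space N) \<inter> (g -` B \<inter> space N)"
    by auto
  ultimately show "emeasure (distr N S f) A * emeasure (distr N T g) B
      = emeasure (distr N (S \<Otimes>\<^sub>M T) (\<lambda>\<omega>. (f \<omega>, g \<omega>))) (A \<times> B)"
    by (simp add: emeasure_distr N.emeasure_eq_measure ennreal_mult)
qed

definition householder :: "'v \<Rightarrow> 'v \<Rightarrow> 'v::real_inner" where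
  "householder a u = u - (2 * (a \<bullet> u) / (a \<bullet> a)) *\<^sub>R a"

lemma householder_linear: "linear (householder a)"
  by (rule linearI) (auto simp: householder_def inner_add_right algebra_simps add_divide_distrib)

lemma householder_norm: "norm (householder a u) = norm u"
proof -
  have "householder a u \<bullet> householder a u = u \<bullet> u"
    by (cases "a = 0") (simp_all add: householder_def inner_diff inner_commute field_simps power2_eq_square)
  then show ?thesis by (simp add: norm_eq_sqrt_inner)
qed

text \<open>
  The reflection acts on \<open>\<mu> + r S u\<close> only through \<open>u\<close>, as the Householder reflection \<open>H\<close> along
  \<open>a = S K e\<^sub>j\<close>. By independence the joint law of \<open>\<xi>\<close> and \<open>U\<close> is a product, which therefore does not
  change when \<open>U\<close> is replaced by \<open>H U\<close>.
\<close>

lemma distr_radial_reflect: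
  fixes U :: "'b \<Rightarrow> real^'n" and \<mu> :: "real^'n"
  assumes N: "prob_space N"
    and [measurable]: "\<xi> \<in> borel_measurable N" "U \<in> borel_measurable N"
    and ind: "prob_space.indep_set N
       {\<xi> -` A \<inter> space N | A. A \<in> sets borel} {U -` B \<inter> space N | B. B \<in> sets borel}"
    and U: "distr N borel U = uniform_sphere"
    and \<Sigma>: "pos_def_matrix \<Sigma>"
  defines "S \<equiv> matrix_sqrt \<Sigma>" and "K \<equiv> matrix_inv \<Sigma>"
  defines "Z \<equiv> \<lambda>\<omega>. \<mu> + \<xi> \<omega> *\<^sub>R (S *v U \<omega>)"
  shows "distr N borel (\<lambda>\<omega>. reflect K \<mu> j (Z \<omega>)) = distr N borel Z"
proof -
  interpret N: prob_space N by fact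
  define a where "a = S *v (K *v axis j 1)"
  have Sa: "S *v a = axis j 1"
    unfolding a_def S_def K_def by (rule matrix_sqrt_inv[OF \<Sigma>])
  have score: "(K *v (S *v u)) $ j = a \<bullet> u" for u
    unfolding a_def S_def K_def by (rule matrix_inv_sqrt_nth[OF \<Sigma>])
  have aa: "a \<bullet> a = K $ j $ j"
    using score[of a] by (simp add: Sa matrix_vector_mult_basis column_def)
  define H where "H = householder a"
  have reflZ: "reflect K \<mu> j (\<mu> + r *\<^sub>R (S *v u)) = \<mu> + r *\<^sub>R (S *v H u)" for r u
    by (simp add: reflect_def H_def householder_def matrix_vector_mult_scaleR score aa
        matrix_vector_mult_diff_distrib Sa algebra_simps)
  have H: "linear H" "\<And>x. norm (H x) = norm x"
    by (simp_all add: H_def householder_linear householder_norm)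
  have Hm [measurable]: "H \<in> borel_measurable borel"
    using H(1) by (intro borel_measurable_continuous_onI linear_continuous_on) (simp add: linear_conv_bounded_linear)
  let ?P = "distr N borel \<xi> \<Otimes>\<^sub>M (uniform_sphere :: (real^'n) measure)"
  have joint: "distr N (borel \<Otimes>\<^sub>M borel) (\<lambda>\<omega>. (\<xi> \<omega>, U \<omega>)) = ?P"
    using distr_pair_indep[OF N _ _ ind] by (simp add: U)
  have "prob_space (uniform_sphere :: (real^'n) measure)"
    unfolding U[symmetric] by (rule N.prob_space_distr) simp
  then interpret us: prob_space "uniform_sphere :: (real^'n) measure" .
  have sets_us [measurable_cong]: "sets (uniform_sphere :: (real^'n) measure) = sets borel"
    by (simp add: uniform_sphere_def)
  have "distr ?P (borel \<Otimes>\<^sub>M borel) (\<lambda>(r, u). (r, H u))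
      = distr (distr N borel \<xi>) borel (\<lambda>r. r) \<Otimes>\<^sub>M distr uniform_sphere borel H"
    by (rule pair_measure_distr[symmetric])
      (auto simp: uniform_sphere_linear_isometry[OF H] us.sigma_finite_measure_axioms)
  then have rot: "distr ?P (borel \<Otimes>\<^sub>M borel) (\<lambda>(r, u). (r, H u)) = ?P"
    by (simp add: uniform_sphere_linear_isometry[OF H] distr_distr comp_def)
  define F where "F = (\<lambda>(r, u). \<mu> + r *\<^sub>R (S *v u))"
  have [measurable]: "F \<in> borel_measurable (borel \<Otimes>\<^sub>M borel)"
    unfolding F_def by measurable
  have "distr N borel (\<lambda>\<omega>. reflect K \<mu> j (Z \<omega>)) = distr (distr N (borel \<Otimes>\<^sub>M borel) (\<lambda>\<omega>. (\<xi> \<omega>, U \<omega>))) borel (\<lambda>(r, u). F (r, H u))"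
    by (subst distr_distr) (auto simp: comp_def F_def Z_def reflZ)
  also have "\<dots> = distr (distr ?P (borel \<Otimes>\<^sub>M borel) (\<lambda>(r, u). (r, H u))) borel F"
    unfolding joint by (subst distr_distr) (auto simp: comp_def case_prod_unfold)
  also have "\<dots> = distr N borel Z"
    unfolding rot unfolding joint[symmetric] by (subst distr_distr) (auto simp: comp_def F_def Z_def)
  finally show ?thesis .
qed

section \<open>Conditional expectations and antisymmetry\<close>

lemma split_ennreal:
  fixes a b :: real
  shows "ennreal (a * b) = ennreal a * ennreal b + ennreal (- a) * ennreal (- b)"
proof (cases "a \<ge> 0")
  case True
  then show ?thesis by (simp add: ennreal_mult' ennreal_neg)
next
  case False
  have "ennreal (a * b) = ennreal ((- a) * (- b))" by simp
  also have "\<dots> = ennreal (- a) * ennreal (- b)" by (rule ennreal_mult') (use False in auto)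
  finally show ?thesis using False by (simp add: ennreal_neg)
qed

text \<open>
  The assumption \<open>sym\<close> says that the positive and the negative part of \<open>W\<close> have the same conditional
  expectation given \<open>G\<close>, hence the same integral against every nonnegative \<open>G\<close>-measurable function.
  The positive part of \<open>h W\<close> is \<open>h\<^sup>+ W\<^sup>+ + h\<^sup>- W\<^sup>-\<close> and its negative part is \<open>h\<^sup>+ W\<^sup>- + h\<^sup>- W\<^sup>+\<close>, so these
  have equal integrals over every set of \<open>F\<close>. All these integrals are of nonnegative
  functions, which covers products \<open>h W\<close> of infinite absolute moment.
\<close>

lemma real_cond_exp_mult_antisymmetric:
  assumes M: "finite_measure M" and G: "subalgebra M G" and F: "subalgebra G F"
    and [measurable]: "W \<in> borel_measurable M"
    and h: "h \<in> borel_measurable G"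
    and sym: "\<And>A. A \<in> sets G \<Longrightarrow> (\<integral>\<^sup>+x\<in>A. ennreal (W x) \<partial>M) = (\<integral>\<^sup>+x\<in>A. ennreal (- W x) \<partial>M)"
  shows "AE x in M. real_cond_exp M F (\<lambda>x. h x * W x) x = 0"
proof -
  interpret finite_measure M by fact
  have MF: "subalgebra M F" using G F by (auto simp: subalgebra_def)
  interpret G: finite_measure_subalgebra M G by unfold_locales fact
  interpret F: finite_measure_subalgebra M F by unfold_locales fact
  have [measurable]: "h \<in> borel_measurable M" by (rule measurable_from_subalg[OF G h])
  have "AE x in M. nn_cond_exp M G (\<lambda>x. ennreal (- W x)) x = nn_cond_exp M G (\<lambda>x. ennreal (W x)) x"
  proof (rule G.nn_cond_exp_charact)
    fix A assume A: "A \<in> sets G"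
    have [measurable]: "indicator A \<in> borel_measurable G" using A by simp
    have "(\<integral>\<^sup>+x\<in>A. nn_cond_exp M G (\<lambda>x. ennreal (- W x)) x \<partial>M) = (\<integral>\<^sup>+x\<in>A. ennreal (- W x) \<partial>M)"
      using G.nn_cond_exp_intg[of "indicator A" "\<lambda>x. ennreal (- W x)"] by (simp add: mult.commute)
    then show "(\<integral>\<^sup>+x\<in>A. ennreal (W x) \<partial>M) = (\<integral>\<^sup>+x\<in>A. nn_cond_exp M G (\<lambda>x. ennreal (- W x)) x \<partial>M)"
      by (simp add: sym[OF A])
  qed auto
  then have eq: "(\<integral>\<^sup>+x. f x * ennreal (W x) \<partial>M) = (\<integral>\<^sup>+x. f x * ennreal (- W x) \<partial>M)"
    if f: "f \<in> borel_measurable G" for f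
  proof -
    assume *: "AE x in M. nn_cond_exp M G (\<lambda>x. ennreal (- W x)) x = nn_cond_exp M G (\<lambda>x. ennreal (W x)) x"
    have "(\<integral>\<^sup>+x. f x * ennreal (W x) \<partial>M) = (\<integral>\<^sup>+x. f x * nn_cond_exp M G (\<lambda>x. ennreal (W x)) x \<partial>M)"
      by (rule G.nn_cond_exp_intg[symmetric, OF f]) simp
    also have "\<dots> = (\<integral>\<^sup>+x. f x * nn_cond_exp M G (\<lambda>x. ennreal (- W x)) x \<partial>M)"
      by (rule nn_integral_cong_AE) (use * in auto)
    also have "\<dots> = (\<integral>\<^sup>+x. f x * ennreal (- W x) \<partial>M)"
      by (rule G.nn_cond_exp_intg[OF f]) simp
    finally show ?thesis .
  qed
  have split': "ennreal (- (a * b)) = ennreal a * ennreal (- b) + ennreal (- a) * ennreal b" for a b :: real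
    using split_ennreal[of a "- b"] by simp
  have "AE x in M. nn_cond_exp M F (\<lambda>x. ennreal (- (h x * W x))) x = nn_cond_exp M F (\<lambda>x. ennreal (h x * W x)) x"
  proof (rule F.nn_cond_exp_charact)
    fix A assume A: "A \<in> sets F"
    then have AG: "A \<in> sets G" using F by (auto simp: subalgebra_def)
    then have AM [measurable]: "A \<in> sets M" using G by (auto simp: subalgebra_def)
    let ?f = "\<lambda>x. indicator A x * ennreal (h x)" and ?g = "\<lambda>x. indicator A x * ennreal (- h x)"
    have fg: "?f \<in> borel_measurable G" "?g \<in> borel_measurable G"
      using h AG by measurable
    have "(\<integral>\<^sup>+x\<in>A. ennreal (h x * W x) \<partial>M)
        = (\<integral>\<^sup>+x. ?f x * ennreal (W x) + ?g x * ennreal (- W x) \<partial>M)"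
      by (simp only: split_ennreal distrib_left distrib_right mult_ac)
    also have "\<dots> = (\<integral>\<^sup>+x. ?f x * ennreal (W x) \<partial>M) + (\<integral>\<^sup>+x. ?g x * ennreal (- W x) \<partial>M)"
      by (rule nn_integral_add) auto
    also have "\<dots> = (\<integral>\<^sup>+x. ?f x * ennreal (- W x) \<partial>M) + (\<integral>\<^sup>+x. ?g x * ennreal (W x) \<partial>M)"
      by (simp only: eq[OF fg(1)] eq[OF fg(2)])
    also have "\<dots> = (\<integral>\<^sup>+x. ?f x * ennreal (- W x) + ?g x * ennreal (W x) \<partial>M)"
      by (rule nn_integral_add[symmetric]) auto
    also have "\<dots> = (\<integral>\<^sup>+x\<in>A. ennreal (- (h x * W x)) \<partial>M)"
      by (simp only: split' distrib_left distrib_right mult_ac add_ac)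
    also have "\<dots> = (\<integral>\<^sup>+x\<in>A. nn_cond_exp M F (\<lambda>x. ennreal (- (h x * W x))) x \<partial>M)"
      using F.nn_cond_exp_intg[of "indicator A" "\<lambda>x. ennreal (- (h x * W x))"] A by (simp add: mult.commute)
    finally show "(\<integral>\<^sup>+x\<in>A. ennreal (h x * W x) \<partial>M) = (\<integral>\<^sup>+x\<in>A. nn_cond_exp M F (\<lambda>x. ennreal (- (h x * W x))) x \<partial>M)" .
  qed auto
  then show ?thesis by (auto simp: real_cond_exp_def)
qed

lemma (in finite_measure) cond_exp_exists_integrable:
  assumes "subalgebra M F" "integrable M Y"
  shows "cond_exp_exists M F Y"
proof -
  interpret F: finite_measure_subalgebra M F by unfold_locales fact
  have [measurable]: "Y \<in> borel_measurable M" using assms(2) by auto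
  have "(\<integral>\<^sup>+\<omega>. nn_cond_exp M F (\<lambda>\<omega>. ennreal \<bar>Y \<omega>\<bar>) \<omega> \<partial>M) = (\<integral>\<^sup>+\<omega>. ennreal \<bar>Y \<omega>\<bar> \<partial>M)"
    using F.nn_cond_exp_intg[of "\<lambda>_. 1" "\<lambda>\<omega>. ennreal \<bar>Y \<omega>\<bar>"] by simp
  also have "\<dots> \<noteq> \<infinity>" using assms(2) by (simp add: integrable_iff_bounded)
  finally have "AE \<omega> in M. nn_cond_exp M F (\<lambda>\<omega>. ennreal \<bar>Y \<omega>\<bar>) \<omega> \<noteq> \<infinity>"
    by (intro nn_integral_PInf_AE) auto
  then show ?thesis by (simp add: cond_exp_exists_def less_top[symmetric])
qed

text \<open>
  Removing an arbitrary set of coordinates is needed because the symmetry holds conditionally on all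
  coordinates but one, whereas the covariance is conditional on all but two.
\<close>

definition sigma_remove :: "'a measure \<Rightarrow> ('a \<Rightarrow> real^'n) \<Rightarrow> 'n set \<Rightarrow> 'a measure" where
  "sigma_remove M X J =
     vimage_algebra (space M) (\<lambda>\<omega>. \<lambda>k\<in>UNIV - J. X \<omega> $ k) (PiM (UNIV - J) (\<lambda>_. borel))"

lemma sigma_remove2_eq: "sigma_remove2 M X i j = sigma_remove M X {i, j}"
  by (simp add: sigma_remove2_def sigma_remove_def)

lemma measurable_sigma_remove:
  assumes "k \<notin> J"
  shows "(\<lambda>\<omega>. X \<omega> $ k) \<in> borel_measurable (sigma_remove M X J)"
proof -
  let ?r = "\<lambda>\<omega>. \<lambda>k\<in>UNIV - J. X \<omega> $ k"
  have "?r \<in> measurable (sigma_remove M X J) (PiM (UNIV - J) (\<lambda>_. borel))"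
    unfolding sigma_remove_def by (rule measurable_vimage_algebra1) (auto simp: space_PiM)
  from measurable_compose[OF this measurable_component_singleton[of k]]
  have "(\<lambda>\<omega>. ?r \<omega> k) \<in> borel_measurable (sigma_remove M X J)"
    using assms by simp
  then show ?thesis using assms by simp
qed

lemma subalgebra_sigma_remove:
  assumes "space G = space M" "\<And>k. k \<notin> J \<Longrightarrow> (\<lambda>\<omega>. X \<omega> $ k) \<in> borel_measurable G"
  shows "subalgebra G (sigma_remove M X J)"
  unfolding subalgebra_def
proof
  show "space (sigma_remove M X J) = space G" by (simp add: sigma_remove_def assms)
  show "sets (sigma_remove M X J) \<subseteq> sets G"
    unfolding sigma_remove_def
    by (rule sets_image_in_sets) (auto simp: assms intro!: measurable_restrict)
qed

section \<open>Reflection-symmetric random vectors\<close>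

text \<open>
  The features of an elliptical vector that carry the equivalence: finite second moments and
  invariance of its law under the reflections along all coordinate axes.
\<close>

locale reflection_symmetric_vector = prob_space M for M :: "'a measure" +
  fixes X :: "'a \<Rightarrow> real^'n" and K :: "real^'n^'n" and \<mu> :: "real^'n"
  assumes X_measurable [measurable]: "X \<in> borel_measurable M"
    and K_sym: "K $ k $ l = K $ l $ k"
    and K_diag: "K $ k $ k > 0"
    and reflect_law: "distr M borel (\<lambda>\<omega>. reflect K \<mu> k (X \<omega>)) = distr M borel X"
    and square_integrable: "integrable M (\<lambda>\<omega>. (X \<omega> $ k)\<^sup>2)"
begin

definition score :: "'n \<Rightarrow> 'a \<Rightarrow> real" where
  "score j \<omega> = (K *v (X \<omega> - \<mu>)) $ j"

lemma score_measurable [measurable]: "score j \<in> borel_measurable M"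
  unfolding score_def[abs_def] by measurable

lemma integrable_X: "integrable M (\<lambda>\<omega>. X \<omega> $ k)"
  by (rule square_integrable_imp_integrable[OF _ square_integrable]) measurable

text \<open>
  The reflection along \<open>e\<^sub>j\<close> preserves the law of \<open>X\<close> and the coordinates that determine \<open>A\<close>, but
  changes the sign of the score.
\<close>

lemma score_antisymmetric:
  assumes "A \<in> sets (sigma_remove M X {j})"
  shows "(\<integral>\<^sup>+\<omega>\<in>A. ennreal (score j \<omega>) \<partial>M) = (\<integral>\<^sup>+\<omega>\<in>A. ennreal (- score j \<omega>) \<partial>M)"
proof -
  let ?P = "PiM (UNIV - {j}) (\<lambda>_. borel) :: ('n \<Rightarrow> real) measure"
  let ?r = "\<lambda>x::real^'n. \<lambda>k\<in>UNIV - {j}. x $ k"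
  have [measurable]: "?r \<in> measurable borel ?P"
    by (intro measurable_restrict measurable_vec_nth) simp
  have "(\<lambda>\<omega>. ?r (X \<omega>)) \<in> space M \<rightarrow> space ?P" by (auto simp: space_PiM)
  then obtain B where B [measurable]: "B \<in> sets ?P" and A: "A = (\<lambda>\<omega>. ?r (X \<omega>)) -` B \<inter> space M"
    using assms unfolding sigma_remove_def by (auto simp: sets_vimage_algebra2)
  define f where "f x = ennreal ((K *v (x - \<mu>)) $ j) * indicator B (?r x)" for x
  have [measurable]: "f \<in> borel_measurable borel" unfolding f_def by measurable
  have "(\<integral>\<^sup>+\<omega>\<in>A. ennreal (score j \<omega>) \<partial>M) = (\<integral>\<^sup>+\<omega>. f (X \<omega>) \<partial>M)"
    by (rule nn_integral_cong) (auto simp: f_def score_def A indicator_def)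
  also have "\<dots> = (\<integral>\<^sup>+x. f x \<partial>distr M borel (\<lambda>\<omega>. reflect K \<mu> j (X \<omega>)))"
    unfolding reflect_law by (subst nn_integral_distr) auto
  also have "\<dots> = (\<integral>\<^sup>+\<omega>. f (reflect K \<mu> j (X \<omega>)) \<partial>M)"
    by (subst nn_integral_distr) auto
  also have "\<dots> = (\<integral>\<^sup>+\<omega>\<in>A. ennreal (- score j \<omega>) \<partial>M)"
  proof (rule nn_integral_cong)
    fix \<omega> assume "\<omega> \<in> space M"
    moreover have "?r (reflect K \<mu> j (X \<omega>)) = ?r (X \<omega>)"
      by (rule restrict_ext) (simp add: reflect_nth)
    ultimately show "f (reflect K \<mu> j (X \<omega>)) = ennreal (- score j \<omega>) * indicator A \<omega>"
      using K_diag[of j] by (auto simp: f_def score_def A indicator_def reflect_score)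
  qed
  finally show ?thesis .
qed

lemma subalgebras:
  shows "subalgebra M (sigma_remove M X J)"
    and "J \<subseteq> J' \<Longrightarrow> subalgebra (sigma_remove M X J) (sigma_remove M X J')"
proof -
  show "subalgebra M (sigma_remove M X J)"
    by (rule subalgebra_sigma_remove) auto
  show "subalgebra (sigma_remove M X J) (sigma_remove M X J')" if "J \<subseteq> J'"
  proof (rule subalgebra_sigma_remove)
    show "space (sigma_remove M X J) = space M" by (simp add: sigma_remove_def)
    show "(\<lambda>\<omega>. X \<omega> $ k) \<in> borel_measurable (sigma_remove M X J)" if "k \<notin> J'" for k
      using that \<open>J \<subseteq> J'\<close> by (intro measurable_sigma_remove) auto
  qed
qed

lemma cond_exp_mult_score:
  assumes "h \<in> borel_measurable (sigma_remove M X {j})" "j \<in> J"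
  shows "AE \<omega> in M. real_cond_exp M (sigma_remove M X J) (\<lambda>\<omega>. h \<omega> * score j \<omega>) \<omega> = 0"
  by (rule real_cond_exp_mult_antisymmetric[OF _ subalgebras(1) subalgebras(2) score_measurable assms(1) score_antisymmetric])
    (use assms in \<open>auto intro: finite_measure_axioms\<close>)

definition residual :: "'n set \<Rightarrow> 'n \<Rightarrow> 'a \<Rightarrow> real" where
  "residual J k \<omega> = X \<omega> $ k - real_cond_exp M (sigma_remove M X J) (\<lambda>\<omega>. X \<omega> $ k) \<omega>"

text \<open>
  The score is affine in \<open>X\<close>, with coefficients \<open>K\<^sub>j\<^sub>j\<close> and \<open>K\<^sub>i\<^sub>j\<close> at \<open>X\<^sub>j\<close> and \<open>X\<^sub>i\<close>; subtracting from it its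
  conditional expectation, which is 0, removes the contribution of the other coordinates.
\<close>

lemma score_eq_residuals:
  assumes "i \<noteq> j"
  shows "AE \<omega> in M. score j \<omega> = K $ j $ j * residual {i, j} j \<omega> + K $ i $ j * residual {i, j} i \<omega>"
proof -
  let ?F = "sigma_remove M X {i, j}"
  interpret F: finite_measure_subalgebra M ?F by unfold_locales (rule subalgebras)
  define L where "L \<omega> = (\<Sum>k\<in>UNIV - {i, j}. K $ j $ k * (X \<omega> $ k - \<mu> $ k)) - K $ j $ j * \<mu> $ j - K $ i $ j * \<mu> $ i" for \<omega>
  have expand: "score j \<omega> = (K $ j $ j * X \<omega> $ j + K $ i $ j * X \<omega> $ i) + L \<omega>" for \<omega>
  proof -
    have "score j \<omega> = (\<Sum>k\<in>{i, j} \<union> (UNIV - {i, j}). K $ j $ k * (X \<omega> $ k - \<mu> $ k))"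
      by (simp add: score_def matrix_vector_mult_def)
    also have "\<dots> = (\<Sum>k\<in>{i, j}. K $ j $ k * (X \<omega> $ k - \<mu> $ k)) + (\<Sum>k\<in>UNIV - {i, j}. K $ j $ k * (X \<omega> $ k - \<mu> $ k))"
      by (rule sum.union_disjoint) auto
    also have "\<dots> = (K $ j $ j * X \<omega> $ j + K $ i $ j * X \<omega> $ i) + L \<omega>"
      using assms by (simp add: L_def K_sym[of j i] right_diff_distrib)
    finally show ?thesis .
  qed
  have LF: "L \<in> borel_measurable ?F"
    unfolding L_def[abs_def]
    by (intro borel_measurable_diff borel_measurable_sum borel_measurable_times borel_measurable_const
        measurable_sigma_remove) auto
  have Lint: "integrable M L"
    unfolding L_def[abs_def] using integrable_X by auto
  \<comment> \<open>the factor 1 puts the score into the form \<open>h \<cdot> score j\<close>\<close>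
  have "AE \<omega> in M. real_cond_exp M ?F (\<lambda>\<omega>. 1 * score j \<omega>) \<omega> = 0"
    by (rule cond_exp_mult_score) auto
  moreover have "AE \<omega> in M. real_cond_exp M ?F (\<lambda>\<omega>. (K $ j $ j * X \<omega> $ j + K $ i $ j * X \<omega> $ i) + L \<omega>) \<omega>
     = real_cond_exp M ?F (\<lambda>\<omega>. K $ j $ j * X \<omega> $ j + K $ i $ j * X \<omega> $ i) \<omega> + real_cond_exp M ?F L \<omega>"
    by (rule F.real_cond_exp_add) (use integrable_X Lint in auto)
  moreover have "AE \<omega> in M. real_cond_exp M ?F (\<lambda>\<omega>. K $ j $ j * X \<omega> $ j + K $ i $ j * X \<omega> $ i) \<omega>
     = real_cond_exp M ?F (\<lambda>\<omega>. K $ j $ j * X \<omega> $ j) \<omega> + real_cond_exp M ?F (\<lambda>\<omega>. K $ i $ j * X \<omega> $ i) \<omega>"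
    by (rule F.real_cond_exp_add) (use integrable_X in auto)
  moreover have "AE \<omega> in M. real_cond_exp M ?F (\<lambda>\<omega>. K $ j $ j * X \<omega> $ j) \<omega> = K $ j $ j * real_cond_exp M ?F (\<lambda>\<omega>. X \<omega> $ j) \<omega>"
      "AE \<omega> in M. real_cond_exp M ?F (\<lambda>\<omega>. K $ i $ j * X \<omega> $ i) \<omega> = K $ i $ j * real_cond_exp M ?F (\<lambda>\<omega>. X \<omega> $ i) \<omega>"
    by (rule F.real_cond_exp_cmult[OF integrable_X])+
  moreover have "AE \<omega> in M. real_cond_exp M ?F L \<omega> = L \<omega>"
    by (rule F.real_cond_exp_F_meas[OF Lint LF])
  ultimately show ?thesis
    by eventually_elim (simp add: expand residual_def algebra_simps)
qed

lemma residual_measurable [measurable]: "residual J k \<in> borel_measurable M"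
  unfolding residual_def[abs_def] by measurable

lemma residual_square_integrable: "integrable M (\<lambda>\<omega>. (residual J k \<omega>)\<^sup>2)"
proof -
  let ?F = "sigma_remove M X J"
  interpret F: finite_measure_subalgebra M ?F by unfold_locales (rule subalgebras)
  have *: "integrable M (\<lambda>\<omega>. (real_cond_exp M ?F (\<lambda>\<omega>. X \<omega> $ k) \<omega>)\<^sup>2)"
    by (rule F.integrable_convex_cond_exp[where I = UNIV and q = "\<lambda>x. x\<^sup>2"])
      (auto simp: integrable_X square_integrable convex_power2)
  show ?thesis
  proof (rule Bochner_Integration.integrable_bound)
    show "integrable M (\<lambda>\<omega>. 2 * (X \<omega> $ k)\<^sup>2 + 2 * (real_cond_exp M ?F (\<lambda>\<omega>. X \<omega> $ k) \<omega>)\<^sup>2)"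
      using * square_integrable by auto
    have "(a - b)\<^sup>2 \<le> 2 * a\<^sup>2 + 2 * b\<^sup>2" for a b :: real
      using zero_le_power2[of "a + b"] by (simp add: power2_eq_square algebra_simps)
    then show "AE \<omega> in M. norm ((residual J k \<omega>)\<^sup>2)
        \<le> norm (2 * (X \<omega> $ k)\<^sup>2 + 2 * (real_cond_exp M ?F (\<lambda>\<omega>. X \<omega> $ k) \<omega>)\<^sup>2)"
      by (simp add: residual_def)
  qed measurable
qed

lemma residual_mult_integrable: "integrable M (\<lambda>\<omega>. residual J k \<omega> * residual J l \<omega>)"
proof (rule Bochner_Integration.integrable_bound)
  show "integrable M (\<lambda>\<omega>. (residual J k \<omega>)\<^sup>2 + (residual J l \<omega>)\<^sup>2)"
    using residual_square_integrable by auto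
  have "\<bar>a * b\<bar> \<le> a\<^sup>2 + b\<^sup>2" for a b :: real
  proof -
    have "2 * \<bar>a * b\<bar> \<le> a\<^sup>2 + b\<^sup>2"
      using sum_squares_bound[of "\<bar>a\<bar>" "\<bar>b\<bar>"] by (simp add: abs_mult)
    then show ?thesis using abs_ge_zero[of "a * b"] by linarith
  qed
  then show "AE \<omega> in M. norm (residual J k \<omega> * residual J l \<omega>)
      \<le> norm ((residual J k \<omega>)\<^sup>2 + (residual J l \<omega>)\<^sup>2)"
    by simp
qed measurable

text \<open>
  By \<open>score_eq_residuals\<close> the residual of \<open>X\<^sub>j\<close> is a multiple of \<open>score j\<close>, and the factor from
  \<open>g(X\<^sub>i)\<close> does not involve \<open>X\<^sub>j\<close>.
\<close>

lemma cond_cov_zero_if: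
  assumes "i \<noteq> j" "K $ i $ j = 0" and [measurable]: "g \<in> borel_measurable borel"
  shows "AE \<omega> in M. cond_cov M (sigma_remove M X {i, j}) (\<lambda>\<omega>. g (X \<omega> $ i)) (\<lambda>\<omega>. X \<omega> $ j) \<omega> = 0"
proof -
  let ?F = "sigma_remove M X {i, j}" and ?G = "sigma_remove M X {j}"
  interpret F: finite_measure_subalgebra M ?F by unfold_locales (rule subalgebras)
  define h where "h \<omega> = (g (X \<omega> $ i) - real_cond_exp M ?F (\<lambda>\<omega>. g (X \<omega> $ i)) \<omega>) / K $ j $ j" for \<omega>
  have "(\<lambda>\<omega>. X \<omega> $ i) \<in> borel_measurable ?G"
    using assms(1) by (intro measurable_sigma_remove) auto
  moreover have "real_cond_exp M ?F (\<lambda>\<omega>. g (X \<omega> $ i)) \<in> borel_measurable ?G"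
    by (rule measurable_from_subalg[OF subalgebras(2)[of "{j}" "{i, j}"]]) auto
  ultimately have hG: "h \<in> borel_measurable ?G"
    unfolding h_def[abs_def] by measurable
  have [measurable]: "h \<in> borel_measurable M"
    by (rule measurable_from_subalg[OF subalgebras(1) hG])
  have "AE \<omega> in M. centred_product M ?F (\<lambda>\<omega>. g (X \<omega> $ i)) (\<lambda>\<omega>. X \<omega> $ j) \<omega> = h \<omega> * score j \<omega>"
    using score_eq_residuals[OF assms(1)]
  proof eventually_elim
    case (elim \<omega>)
    then show ?case
      using K_diag[of j] assms(2) by (simp add: centred_product_def h_def residual_def)
  qed
  then have "AE \<omega> in M. cond_cov M ?F (\<lambda>\<omega>. g (X \<omega> $ i)) (\<lambda>\<omega>. X \<omega> $ j) \<omega>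
      = real_cond_exp M ?F (\<lambda>\<omega>. h \<omega> * score j \<omega>) \<omega>"
    unfolding cond_cov_def by (rule F.real_cond_exp_cong) (auto simp: centred_product_def[abs_def])
  moreover have "AE \<omega> in M. real_cond_exp M ?F (\<lambda>\<omega>. h \<omega> * score j \<omega>) \<omega> = 0"
    by (rule cond_exp_mult_score[OF hG]) simp
  ultimately show ?thesis by eventually_elim simp
qed

lemma centred_product_eq: "centred_product M (sigma_remove M X J) (\<lambda>\<omega>. X \<omega> $ i) (\<lambda>\<omega>. X \<omega> $ j)
    = (\<lambda>\<omega>. residual J i \<omega> * residual J j \<omega>)"
  by (simp add: centred_product_def residual_def)

lemma cond_cov_exists_id: "cond_cov_exists M (sigma_remove M X J) (\<lambda>\<omega>. X \<omega> $ i) (\<lambda>\<omega>. X \<omega> $ j)"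
  unfolding cond_cov_exists_def centred_product_eq
  using cond_exp_exists_integrable[OF subalgebras(1)] integrable_X residual_mult_integrable by blast

text \<open>
  The residual of \<open>X\<^sub>i\<close> is uncorrelated with \<open>score j\<close> by symmetry and with the residual of \<open>X\<^sub>j\<close> by
  assumption. As \<open>score j\<close> is a combination of the two residuals, its remaining term
  \<open>K\<^sub>i\<^sub>j E(Y\<^sub>i\<^sup>2)\<close> is 0.
\<close>

lemma residual_zero:
  assumes "i \<noteq> j" "K $ i $ j \<noteq> 0" and uncor: "(LINT \<omega>|M. residual {i, j} i \<omega> * residual {i, j} j \<omega>) = 0"
  shows "AE \<omega> in M. residual {i, j} i \<omega> = 0"
proof -
  let ?F = "sigma_remove M X {i, j}" and ?Y = "residual {i, j}"
  interpret F: finite_measure_subalgebra M ?F by unfold_locales (rule subalgebras)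
  have "(\<lambda>\<omega>. X \<omega> $ i) \<in> borel_measurable (sigma_remove M X {j})"
    using assms(1) by (intro measurable_sigma_remove) auto
  moreover have "real_cond_exp M ?F (\<lambda>\<omega>. X \<omega> $ i) \<in> borel_measurable (sigma_remove M X {j})"
    by (rule measurable_from_subalg[OF subalgebras(2)[of "{j}" "{i, j}"]]) auto
  ultimately have YG: "?Y i \<in> borel_measurable (sigma_remove M X {j})"
    unfolding residual_def[abs_def] by measurable
  have eq: "AE \<omega> in M. ?Y i \<omega> * score j \<omega> = K $ j $ j * (?Y i \<omega> * ?Y j \<omega>) + K $ i $ j * (?Y i \<omega>)\<^sup>2"
    using score_eq_residuals[OF assms(1)] by eventually_elim (simp add: algebra_simps power2_eq_square)
  have int: "integrable M (\<lambda>\<omega>. K $ j $ j * (?Y i \<omega> * ?Y j \<omega>) + K $ i $ j * (?Y i \<omega>)\<^sup>2)"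
    using residual_mult_integrable residual_square_integrable by auto
  then have "integrable M (\<lambda>\<omega>. ?Y i \<omega> * score j \<omega>)"
    by (subst integrable_cong_AE[OF _ _ eq]) auto
  then have "(LINT \<omega>|M. ?Y i \<omega> * score j \<omega>) = (LINT \<omega>|M. real_cond_exp M ?F (\<lambda>\<omega>. ?Y i \<omega> * score j \<omega>) \<omega>)"
    by (rule F.real_cond_exp_int(2)[symmetric])
  also have "\<dots> = 0"
    using cond_exp_mult_score[OF YG, of "{i, j}"] by (subst integral_cong_AE[where g = "\<lambda>_. 0"]) auto
  finally have "(LINT \<omega>|M. K $ j $ j * (?Y i \<omega> * ?Y j \<omega>) + K $ i $ j * (?Y i \<omega>)\<^sup>2) = 0"
    using integral_cong_AE[OF _ _ eq] by simp
  then have "K $ i $ j * (LINT \<omega>|M. (?Y i \<omega>)\<^sup>2) = 0"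
    using residual_mult_integrable residual_square_integrable uncor
    by (subst (asm) Bochner_Integration.integral_add) auto
  then have "(LINT \<omega>|M. (?Y i \<omega>)\<^sup>2) = 0" using assms(2) by simp
  then show ?thesis
    using residual_square_integrable by (subst (asm) integral_nonneg_eq_0_iff_AE) auto
qed

lemma precision_zero_if_cond_cov_zero:
  assumes "i \<noteq> j" and nondeg: "\<not> (AE \<omega> in M. score j \<omega> = 0)"
    and cov: "AE \<omega> in M. cond_cov M (sigma_remove M X {i, j}) (\<lambda>\<omega>. X \<omega> $ i) (\<lambda>\<omega>. X \<omega> $ j) \<omega> = 0"
  shows "K $ i $ j = 0"
proof (rule ccontr)
  assume nz: "K $ i $ j \<noteq> 0"
  let ?F = "sigma_remove M X {i, j}" and ?Y = "residual {i, j}"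
  interpret F: finite_measure_subalgebra M ?F by unfold_locales (rule subalgebras)
  have "(LINT \<omega>|M. ?Y i \<omega> * ?Y j \<omega>) = (LINT \<omega>|M. real_cond_exp M ?F (\<lambda>\<omega>. ?Y i \<omega> * ?Y j \<omega>) \<omega>)"
    by (rule F.real_cond_exp_int(2)[symmetric, OF residual_mult_integrable])
  also have "\<dots> = 0"
    using cov unfolding cond_cov_def centred_product_eq
    by (subst integral_cong_AE[where g = "\<lambda>_. 0"]) auto
  finally have uncor: "(LINT \<omega>|M. ?Y i \<omega> * ?Y j \<omega>) = 0" .
  have "AE \<omega> in M. ?Y i \<omega> = 0"
    by (rule residual_zero[OF assms(1) nz uncor])
  moreover have "AE \<omega> in M. ?Y j \<omega> = 0"
    using residual_zero[of j i] assms(1) nz uncor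
    by (simp add: K_sym[of j i] insert_commute mult.commute)
  ultimately have "AE \<omega> in M. score j \<omega> = 0"
    using score_eq_residuals[OF assms(1)] by eventually_elim simp
  with nondeg show False by contradiction
qed

end

section \<open>Elliptical vectors\<close>

lemma stochastic_representation_reflection_symmetric:
  fixes X :: "'a \<Rightarrow> real^'n" and U :: "'b \<Rightarrow> real^'n"
  assumes M: "prob_space M" and X [measurable]: "X \<in> borel_measurable M"
    and \<Sigma>: "pos_def_matrix \<Sigma>"
    and rep: "stochastic_representation M X \<mu> \<Sigma> N \<xi> U"
    and sq: "integrable N (\<lambda>\<omega>. (\<xi> \<omega>)\<^sup>2)"
  shows "reflection_symmetric_vector M X (matrix_inv \<Sigma>) \<mu>"
proof -
  interpret M: prob_space M by fact
  let ?K = "matrix_inv \<Sigma>"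
  define Z where "Z \<omega> = \<mu> + \<xi> \<omega> *\<^sub>R (matrix_sqrt \<Sigma> *v U \<omega>)" for \<omega>
  have N: "prob_space N" and [measurable]: "\<xi> \<in> borel_measurable N" "U \<in> borel_measurable N"
    and ind: "prob_space.indep_set N
       {\<xi> -` A \<inter> space N | A. A \<in> sets borel} {U -` B \<inter> space N | B. B \<in> sets borel}"
    and U: "distr N borel U = uniform_sphere" and law: "distr M borel X = distr N borel Z"
    using rep unfolding stochastic_representation_def Z_def[abs_def] by auto
  interpret N: prob_space N by fact
  have [measurable]: "Z \<in> borel_measurable N" unfolding Z_def[abs_def] by measurable
  show ?thesis
  proof
    fix k l
    have K: "pos_def_matrix ?K" by (rule pos_def_matrix_inv[OF \<Sigma>])
    then have "transpose ?K $ k $ l = ?K $ k $ l" by (simp add: pos_def_matrix_def)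
    then show "?K $ k $ l = ?K $ l $ k" by (simp add: transpose_def)
    have "0 < axis k 1 \<bullet> (?K *v axis k 1)" using K by (simp add: pos_def_matrix_def axis_eq_0_iff)
    then show "0 < ?K $ k $ k" by (simp add: inner_axis' matrix_vector_mult_basis column_def)
    have "distr M borel (\<lambda>\<omega>. reflect ?K \<mu> k (X \<omega>)) = distr (distr M borel X) borel (reflect ?K \<mu> k)"
      by (subst distr_distr) (auto simp: comp_def)
    also have "\<dots> = distr N borel (\<lambda>\<omega>. reflect ?K \<mu> k (Z \<omega>))"
      unfolding law by (subst distr_distr) (auto simp: comp_def)
    also have "\<dots> = distr M borel X"
      unfolding law Z_def[abs_def] by (rule distr_radial_reflect[OF N _ _ ind U \<Sigma>]) auto
    finally show "distr M borel (\<lambda>\<omega>. reflect ?K \<mu> k (X \<omega>)) = distr M borel X" .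
    obtain L where L: "L > 0" "\<And>x. norm (matrix_sqrt \<Sigma> *v x) \<le> norm x * L"
      using bounded_linear.pos_bounded[OF matrix_vector_mul_bounded_linear[of "matrix_sqrt \<Sigma>"]] by blast
    have "AE u in distr N borel U. norm u \<le> 1" unfolding U by (rule uniform_sphere_norm_le)
    then have U1: "AE \<omega> in N. norm (U \<omega>) \<le> 1" by (subst (asm) AE_distr_iff) auto
    have "integrable N (\<lambda>\<omega>. (Z \<omega> $ k)\<^sup>2)"
    proof (rule Bochner_Integration.integrable_bound)
      show "integrable N (\<lambda>\<omega>. 2 * (\<mu> $ k)\<^sup>2 + 2 * L\<^sup>2 * (\<xi> \<omega>)\<^sup>2)" using sq by auto
      show "AE \<omega> in N. norm ((Z \<omega> $ k)\<^sup>2) \<le> norm (2 * (\<mu> $ k)\<^sup>2 + 2 * L\<^sup>2 * (\<xi> \<omega>)\<^sup>2)"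
        using U1
      proof eventually_elim
        case (elim \<omega>)
        have sum_sq: "(a + b)\<^sup>2 \<le> 2 * a\<^sup>2 + 2 * b\<^sup>2" for a b :: real
          using zero_le_power2[of "a - b"] by (simp add: power2_eq_square algebra_simps)
        have "\<bar>(matrix_sqrt \<Sigma> *v U \<omega>) $ k\<bar> \<le> norm (U \<omega>) * L"
          using component_le_norm_cart L(2) order.trans by blast
        also have "\<dots> \<le> L" using elim L(1) by simp
        finally have "((matrix_sqrt \<Sigma> *v U \<omega>) $ k)\<^sup>2 \<le> L\<^sup>2"
          using L(1) by (simp add: abs_le_square_iff[symmetric])
        then have "(\<xi> \<omega> * (matrix_sqrt \<Sigma> *v U \<omega>) $ k)\<^sup>2 \<le> L\<^sup>2 * (\<xi> \<omega>)\<^sup>2"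
          by (simp add: power_mult_distrib mult.commute[of "L\<^sup>2"] mult_left_mono)
        then show ?case
          using sum_sq[of "\<mu> $ k" "\<xi> \<omega> * (matrix_sqrt \<Sigma> *v U \<omega>) $ k"] by (simp add: Z_def)
      qed
    qed measurable
    then have "integrable (distr M borel X) (\<lambda>x. (x $ k)\<^sup>2)"
      unfolding law by (subst integrable_distr_eq) auto
    then show "integrable M (\<lambda>\<omega>. (X \<omega> $ k)\<^sup>2)"
      by (subst (asm) integrable_distr_eq) auto
  qed (rule X)
qed

text \<open>
  The score of the representation is \<open>\<xi>\<close> times \<open>a \<bullet> U\<close> for a nonzero vector \<open>a\<close>, and \<open>U\<close> almost surely
  avoids the hyperplane orthogonal to \<open>a\<close>. If the score vanished, so would \<open>\<xi>\<close>, against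
  \<open>E \<xi>\<^sup>2 > 0\<close>.
\<close>

lemma stochastic_representation_nondegenerate:
  fixes X :: "'a \<Rightarrow> real^'n" and U :: "'b \<Rightarrow> real^'n"
  assumes X [measurable]: "X \<in> borel_measurable M"
    and \<Sigma>: "pos_def_matrix \<Sigma>"
    and rep: "stochastic_representation M X \<mu> \<Sigma> N \<xi> U"
    and pos: "0 < (LINT \<omega>|N. (\<xi> \<omega>)\<^sup>2)"
  shows "\<not> (AE \<omega> in M. (matrix_inv \<Sigma> *v (X \<omega> - \<mu>)) $ j = 0)"
proof
  let ?K = "matrix_inv \<Sigma>"
  define Z where "Z \<omega> = \<mu> + \<xi> \<omega> *\<^sub>R (matrix_sqrt \<Sigma> *v U \<omega>)" for \<omega>
  have [measurable]: "\<xi> \<in> borel_measurable N" "U \<in> borel_measurable N"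
    and U: "distr N borel U = uniform_sphere" and law: "distr M borel X = distr N borel Z"
    using rep unfolding stochastic_representation_def Z_def[abs_def] by auto
  have [measurable]: "Z \<in> borel_measurable N" unfolding Z_def[abs_def] by measurable
  define a where "a = matrix_sqrt \<Sigma> *v (?K *v axis j 1)"
  have "a \<noteq> 0"
    using matrix_sqrt_inv[OF \<Sigma>, of "axis j 1"] by (auto simp: a_def axis_eq_0_iff)
  assume "AE \<omega> in M. (?K *v (X \<omega> - \<mu>)) $ j = 0"
  then have "AE x in distr M borel X. (?K *v (x - \<mu>)) $ j = 0"
    by (subst AE_distr_iff) auto
  then have "AE \<omega> in N. (?K *v (Z \<omega> - \<mu>)) $ j = 0"
    unfolding law by (subst (asm) AE_distr_iff) auto
  then have 1: "AE \<omega> in N. \<xi> \<omega> * (a \<bullet> U \<omega>) = 0"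
    by (simp add: Z_def matrix_vector_mult_scaleR matrix_inv_sqrt_nth[OF \<Sigma>] a_def)
  have "AE u in distr N borel U. a \<bullet> u \<noteq> 0"
    unfolding U by (rule uniform_sphere_hyperplane[OF \<open>a \<noteq> 0\<close>])
  then have "AE \<omega> in N. a \<bullet> U \<omega> \<noteq> 0"
    by (subst (asm) AE_distr_iff) auto
  with 1 have "AE \<omega> in N. (\<xi> \<omega>)\<^sup>2 = 0" by eventually_elim simp
  then have "(LINT \<omega>|N. (\<xi> \<omega>)\<^sup>2) = 0"
    by (subst integral_cong_AE[where g = "\<lambda>_. 0"]) auto
  with pos show False by simp
qed

theorem theorem3p4:
  fixes M :: "'a measure" and X :: "'a \<Rightarrow> real^'n"
    and N :: "'b measure" and \<xi> :: "'b \<Rightarrow> real" and U :: "'b \<Rightarrow> real^'n"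
    and \<mu> :: "real^'n" and \<Sigma> K :: "real^'n^'n" and i j :: 'n
  assumes "prob_space M"
    and "CARD('n) \<ge> 2"
    and "elliptical M X \<mu> \<Sigma>"
    and "pos_def_matrix \<Sigma>"
    and "K = matrix_inv \<Sigma>"
    and "stochastic_representation M X \<mu> \<Sigma> N \<xi> U"
    and "integrable N (\<lambda>\<omega>. (\<xi> \<omega>)\<^sup>2)"
    and "0 < (LINT \<omega>|N. (\<xi> \<omega>)\<^sup>2)"
    and "i \<noteq> j"
  shows "K $ i $ j = 0 \<longleftrightarrow>
    (\<forall>g :: real \<Rightarrow> real. g \<in> borel_measurable borel \<longrightarrow>
       cond_cov_exists M (sigma_remove2 M X i j) (\<lambda>\<omega>. g (X \<omega> $ i)) (\<lambda>\<omega>. X \<omega> $ j) \<longrightarrow>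
       (AE \<omega> in M.
          cond_cov M (sigma_remove2 M X i j) (\<lambda>\<omega>. g (X \<omega> $ i)) (\<lambda>\<omega>. X \<omega> $ j) \<omega> = 0))"
proof -
  have X: "X \<in> borel_measurable M" using assms(3) by (simp add: elliptical_def)
  interpret reflection_symmetric_vector M X K \<mu>
    unfolding assms(5) by (rule stochastic_representation_reflection_symmetric[OF assms(1) X assms(4,6,7)])
  have nondeg: "\<not> (AE \<omega> in M. score j \<omega> = 0)"
    unfolding score_def using stochastic_representation_nondegenerate[OF X assms(4,6,8)] assms(5) by simp
  show ?thesis
    unfolding sigma_remove2_eq
  proof safe
    fix g :: "real \<Rightarrow> real"
    assume "K $ i $ j = 0" "g \<in> borel_measurable borel"
    then show "AE \<omega> in M. cond_cov M (sigma_remove M X {i, j}) (\<lambda>\<omega>. g (X \<omega> $ i)) (\<lambda>\<omega>. X \<omega> $ j) \<omega> = 0"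
      by (rule cond_cov_zero_if[OF assms(9)])
  next
    assume "\<forall>g :: real \<Rightarrow> real. g \<in> borel_measurable borel \<longrightarrow>
       cond_cov_exists M (sigma_remove M X {i, j}) (\<lambda>\<omega>. g (X \<omega> $ i)) (\<lambda>\<omega>. X \<omega> $ j) \<longrightarrow>
       (AE \<omega> in M. cond_cov M (sigma_remove M X {i, j}) (\<lambda>\<omega>. g (X \<omega> $ i)) (\<lambda>\<omega>. X \<omega> $ j) \<omega> = 0)"
    from this[rule_format, of "\<lambda>x. x"]
    show "K $ i $ j = 0"
      using precision_zero_if_cond_cov_zero[OF assms(9) nondeg] cond_cov_exists_id by simp
  qed
qed

end
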